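(* The first moment of the one-parameter family $E: y^2=4x^3+ax^2+bx+c+dt$ (with parameter $t$ and integer coefficients $a,b,c,d$) is $0$, that is, $A_{1,E}(p)=0$.
   Context: Here $p$ is an odd prime and $\left(\frac{\cdot}{p}\right)$ denotes the Legendre symbol, with $\left(\frac{u}{p}\right)=0$ if $p\mid u$. For a family $y^2=f_t(x)$, with $f_t(x)$ a cubic polynomial in $x$ whose coefficients are integer polynomials in $t$, one sets $a_t(p):=p-\#\{(x,y)\in(\mathbb{Z}/p\mathbb{Z})^2: y^2\equiv f_t(x) \bmod p\}=-\sum_{x \bmod p}\left(\frac{f_t(x)}{p}\right)$. The first moment of the family is $A_{1,E}(p):=\frac1p\sum_{t \bmod p}a_t(p)$, the sum running over all residues $t$ modulo $p$.
   Formalization: The formal statement additionally assumes that p does not divide d; otherwise the family is constant mod p and the claim can fail, e.g. p=3, a=1, b=c=0, d=3 gives first moment 1. *)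

theory Defs
  imports Complex_Main "HOL-Computational_Algebra.Polynomial" "HOL-Number_Theory.Cong"
begin

text \<open>A family \<open>y\<^sup>2 = f\<^sub>t(x)\<close> is given by \<open>f \<in> \<int>[t][x]\<close>: the outer polynomial variable is \<open>x\<close>,
  the inner one (in the coefficients) is the parameter \<open>t\<close>.\<close>

definition specialize :: "int poly poly \<Rightarrow> int \<Rightarrow> int poly" where
  "specialize f t = map_poly (\<lambda>q. poly q t) f"

text \<open>Residues modulo \<open>p\<close> are represented by \<open>{0..<int p}\<close>. Only affine points are counted.\<close>

definition curve_points :: "int poly \<Rightarrow> nat \<Rightarrow> (int \<times> int) set" where
  "curve_points g p = {(x, y) \<in> {0..<int p} \<times> {0..<int p}. [y\<^sup>2 = poly g x] (mod int p)}"

definition trace_coeff :: "int poly poly \<Rightarrow> nat \<Rightarrow> int \<Rightarrow> int" where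
  "trace_coeff f p t = int p - int (card (curve_points (specialize f t) p))"

definition first_moment :: "int poly poly \<Rightarrow> nat \<Rightarrow> real" where
  "first_moment f p = (1 / real p) * (\<Sum>t\<in>{0..<int p}. real_of_int (trace_coeff f p t))"

definition E_family :: "int \<Rightarrow> int \<Rightarrow> int \<Rightarrow> int \<Rightarrow> int poly poly" where
  "E_family a b c d = [:[:c, d:], [:b:], [:a:], [:4:]:]"

lemma poly_specialize_E_family:
  "poly (specialize (E_family a b c d) t) x = 4 * x ^ 3 + a * x ^ 2 + b * x + c + d * t"
  by (simp add: specialize_def E_family_def map_poly_pCons algebra_simps
      power2_eq_square power3_eq_cube)

end

theory Submission
  imports Defs
begin

text \<open>The curve equation is linear in \<open>t\<close> with invertible leading coefficient \<open>d\<close>, so each of the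
  \<open>p\<^sup>2\<close> pairs \<open>(x, y)\<close> lies on the curve for exactly one \<open>t\<close> modulo \<open>p\<close>. Hence the point counts of
  the members of the family sum to \<open>p\<^sup>2\<close>, and the traces sum to \<open>p \<cdot> p - p\<^sup>2 = 0\<close>.\<close>

lemma bij_betw_curve_points_pairs:
  assumes "p > 0" and "coprime d (int p)"
    and poly_eq: "\<And>t x. poly (specialize f t) x = g x + d * t"
  shows "bij_betw snd (SIGMA t:{0..<int p}. curve_points (specialize f t) p)
           ({0..<int p} \<times> {0..<int p})"
proof (rule bij_betwI')
  fix P Q
  assume P: "P \<in> (SIGMA t:{0..<int p}. curve_points (specialize f t) p)"
    and Q: "Q \<in> (SIGMA t:{0..<int p}. curve_points (specialize f t) p)"
  obtain s x y where P_eq: "P = (s, x, y)" by (cases P)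
  obtain t x' y' where Q_eq: "Q = (t, x', y')" by (cases Q)
  \<comment> \<open>Injectivity: \<open>snd\<close> forgets only the parameter. For a common point
    both right-hand sides are congruent to \<open>y\<^sup>2\<close>, so \<open>g x\<close> and then
    the unit \<open>d\<close> cancel, and congruent residues in \<open>{0..<int p}\<close>
    coincide.\<close>
  have "s = t" if "(x, y) = (x', y')"
  proof -
    have "[g x + d * s = g x + d * t] (mod int p)"
      using P Q that unfolding P_eq Q_eq curve_points_def poly_eq
      by (auto intro: cong_trans cong_sym)
    then have "[s = t] (mod int p)"
      using assms(2) by (simp add: cong_add_lcancel cong_mult_lcancel)
    then show ?thesis
      using P Q cong_less_imp_eq_int unfolding P_eq Q_eq by auto
  qed
  then show "snd P = snd Q \<longleftrightarrow> P = Q" unfolding P_eq Q_eq by auto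
next
  fix P assume "P \<in> (SIGMA t:{0..<int p}. curve_points (specialize f t) p)"
  then show "snd P \<in> {0..<int p} \<times> {0..<int p}"
    by (auto simp: curve_points_def)
next
  fix R assume "R \<in> {0..<int p} \<times> {0..<int p}"
  then obtain x y where R: "R = (x, y)" "x \<in> {0..<int p}" "y \<in> {0..<int p}" by auto
  \<comment> \<open>Surjectivity: solving the curve equation for the parameter, with
    \<open>e\<close> inverse to \<open>d\<close>, gives \<open>t\<close>; reducing modulo
    \<open>p\<close> puts it in the index range.\<close>
  obtain e where e: "[d * e = 1] (mod int p)"
    using cong_solve_coprime_int[OF assms(2)] by blast
  define t where "t = (e * (y\<^sup>2 - g x)) mod int p"
  have "[d * t = (d * e) * (y\<^sup>2 - g x)] (mod int p)"
    unfolding t_def cong_def by (simp add: mod_mult_right_eq mult.assoc)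
  also have "[(d * e) * (y\<^sup>2 - g x) = 1 * (y\<^sup>2 - g x)] (mod int p)"
    using e by (rule cong_scalar_right)
  finally have "[g x + d * t = g x + (y\<^sup>2 - g x)] (mod int p)"
    by (simp only: mult_1 cong_add_lcancel)
  then have "[y\<^sup>2 = g x + d * t] (mod int p)"
    by (simp only: add_diff_cancel_left' add_diff_eq cong_sym_eq)
  moreover have "t \<in> {0..<int p}" using \<open>p > 0\<close> by (simp add: t_def)
  ultimately have "(t, R) \<in> (SIGMA t:{0..<int p}. curve_points (specialize f t) p)"
    using R by (simp add: curve_points_def poly_eq)
  then show "\<exists>P\<in>(SIGMA t:{0..<int p}. curve_points (specialize f t) p). R = snd P"
    by force
qed

text \<open>Double counting: the sum is the size of the disjoint union of the curves over
  \<open>t\<close>, which the bijection identifies with the full grid of pairs. The shape of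
  \<open>g\<close> is irrelevant; only linearity in \<open>t\<close> matters.\<close>

lemma sum_card_curve_points:
  assumes "p > 0" and "coprime d (int p)"
    and "\<And>t x. poly (specialize f t) x = g x + d * t"
  shows "(\<Sum>t\<in>{0..<int p}. card (curve_points (specialize f t) p)) = p\<^sup>2"
proof -
  have "finite (curve_points h p)" for h
    by (rule finite_subset[of _ "{0..<int p} \<times> {0..<int p}"]) (auto simp: curve_points_def)
  then have "(\<Sum>t\<in>{0..<int p}. card (curve_points (specialize f t) p))
      = card (SIGMA t:{0..<int p}. curve_points (specialize f t) p)"
    by simp
  also have "\<dots> = card ({0..<int p} \<times> {0..<int p})"
    using bij_betw_curve_points_pairs[OF assms] by (rule bij_betw_same_card)
  finally show ?thesis by (simp add: power2_eq_square)
qed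

theorem lemma2p1:
  fixes a b c d :: int and p :: nat
  assumes "prime p" and "odd p" and "\<not> int p dvd d"
  shows "first_moment (E_family a b c d) p = 0"
proof -
  \<comment> \<open>A prime not dividing \<open>d\<close> is coprime to it, so \<open>d\<close> is
    invertible modulo \<open>p\<close>.\<close>
  have "coprime d (int p)"
    using prime_imp_coprime[of "int p" d] assms by (simp add: coprime_commute)
  \<comment> \<open>Here \<open>g x\<close> is \<open>4 * x ^ 3 + a * x ^ 2 + b * x + c\<close>, the
    part free of \<open>t\<close>.\<close>
  then have "(\<Sum>t\<in>{0..<int p}. card (curve_points (specialize (E_family a b c d) t) p)) = p\<^sup>2"
    using prime_gt_0_nat[OF \<open>prime p\<close>]
    by (intro sum_card_curve_points) (auto simp: poly_specialize_E_family)
  then have "(\<Sum>t\<in>{0..<int p}. trace_coeff (E_family a b c d) p t) = 0"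
    by (simp add: trace_coeff_def sum_subtractf power2_eq_square flip: of_nat_sum)
  then show ?thesis
    by (simp add: first_moment_def flip: of_int_sum)
qed

end
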